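(* Let $d\ge 1$, let $\mathcal{K}$ and $\mathcal{K}'$ be admissible $d$-complexes, and let $\mathcal{K}\sqcup\mathcal{K}'$ be their disjoint union. Then $$V_{\mathbb{Z}}(\mathcal{K}\sqcup\mathcal{K}') = V_{\mathbb{Z}}(\mathcal{K})+V_{\mathbb{Z}}(\mathcal{K}').$$
   Context: An admissible $d$-complex is a finite pure simplicial $d$-complex $\mathcal{K}$ (every simplex is a face of a $d$-simplex of $\mathcal{K}$) in which each facet ($d$-simplex) is equipped with an orientation, giving oriented facets $F_1,\dots,F_n$ (each facet occurring once), such that $\sum_i\partial F_i=0$. We also write $\mathcal{K}$ for the $d$-chain $\sum_i F_i$. For $\mathbb{F}\in\{\mathbb{Z},\mathbb{Q}\}$, $C_n(\mathcal{K};\mathbb{F})$ denotes the group of $n$-chains, with coefficients in $\mathbb{F}$, of oriented $n$-simplices on the vertices of $\mathcal{K}$: any $n+1$ distinct vertices of $\mathcal{K}$ span an allowed $n$-simplex, whether or not it is a simplex of $\mathcal{K}$, and an oriented simplex with reversed orientation equals minus the original. The boundary is $\partial[v_0,\dots,v_n]=\sum_i(-1)^i[v_0,\dots,\widehat{v_i},\dots,v_n]$. For a chain $\alpha$, $|\alpha|_1$ is the sum of the absolute values of its coefficients (with one chosen orientation per simplex). Define $V_{\mathbb{F}}(\mathcal{K})$ to be the minimum of $|\alpha|_1$ over all $\alpha\in C_{d+1}(\mathcal{K};\mathbb{F})$ with $\partial\alpha=\mathcal{K}$. The disjoint union $\mathcal{K}\sqcup\mathcal{K}'$ is the admissible $d$-complex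 whose vertex set is the disjoint union of the two vertex sets and whose oriented facets are those of $\mathcal{K}$ together with those of $\mathcal{K}'$. *)

theory Defs
  imports Complex_Main "HOL-Combinatorics.Permutations"
begin

section \<open>Oriented simplicial chains\<close>

text \<open>
  A chain assigns to every ordering of a simplex the coefficient of the corresponding oriented
  simplex; the value is multiplied by the sign of the permutation when the vertices are reordered.
  The possible \<open>n\<close>-simplices are all sets of \<open>n + 1\<close> vertices of \<open>V\<close>.
\<close>

type_synonym ('a, 'r) chain = "'a list \<Rightarrow> 'r"

definition chains :: "nat \<Rightarrow> 'a set \<Rightarrow> ('a, 'r::linordered_idom) chain set" where
  "chains n V = {\<alpha>.
     (\<forall>xs. \<alpha> xs \<noteq> 0 \<longrightarrow> distinct xs \<and> length xs = n + 1 \<and> set xs \<subseteq> V) \<and>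
     (\<forall>xs p. p permutes {..<length xs} \<longrightarrow> \<alpha> (permute_list p xs) = of_int (sign p) * \<alpha> xs)}"

text \<open>
  The chain of a single oriented simplex \<open>[x\<^sub>0, \<dots>, x\<^sub>n]\<close>. If the entries of \<open>xs\<close> are distinct,
  at most one permutation contributes to the sum.
\<close>

definition oriented_simplex :: "'a list \<Rightarrow> ('a, 'r::linordered_idom) chain" where
  "oriented_simplex xs =
     (\<lambda>ys. \<Sum>p | p permutes {..<length xs} \<and> permute_list p xs = ys. of_int (sign p))"

definition simplex_boundary :: "'a list \<Rightarrow> ('a, 'r::linordered_idom) chain" where
  "simplex_boundary xs =
     (\<lambda>ys. \<Sum>i<length xs. (-1) ^ i * oriented_simplex (take i xs @ drop (Suc i) xs) ys)"

definition chain_support :: "('a, 'r::linordered_idom) chain \<Rightarrow> 'a set set" where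
  "chain_support \<alpha> = set ` {xs. \<alpha> xs \<noteq> 0}"

text \<open>
  One orientation is chosen for each finite vertex set; for an element of \<^const>\<open>chains\<close>, neither
  the boundary nor the norm depends on the choice.
\<close>

definition chosen_order :: "'a set \<Rightarrow> 'a list" where
  "chosen_order S = (SOME xs. distinct xs \<and> set xs = S)"

definition boundary :: "('a, 'r::linordered_idom) chain \<Rightarrow> ('a, 'r) chain" where
  "boundary \<alpha> =
     (\<lambda>ys. \<Sum>S\<in>chain_support \<alpha>. \<alpha> (chosen_order S) * simplex_boundary (chosen_order S) ys)"

definition chain_norm :: "('a, 'r::linordered_idom) chain \<Rightarrow> 'r" where
  "chain_norm \<alpha> = (\<Sum>S\<in>chain_support \<alpha>. \<bar>\<alpha> (chosen_order S)\<bar>)"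


section \<open>Admissible complexes\<close>

text \<open>
  Simplices are nonempty vertex sets. The orientation of a facet is recorded by one ordering of its
  vertices, which represents its class modulo even permutations; only the chain of the oriented
  simplex is ever used.
\<close>

record 'a oriented_complex =
  simplices :: "'a set set"
  oriented_facets :: "'a list set"

definition vertices :: "'a oriented_complex \<Rightarrow> 'a set" where
  "vertices K = \<Union> (simplices K)"

definition facets :: "nat \<Rightarrow> 'a oriented_complex \<Rightarrow> 'a set set" where
  "facets d K = {S \<in> simplices K. card S = d + 1}"

definition simplicial_complex :: "'a set set \<Rightarrow> bool" where
  "simplicial_complex \<S> \<longleftrightarrow>
     (\<forall>S\<in>\<S>. finite S \<and> S \<noteq> {}) \<and> (\<forall>S\<in>\<S>. \<forall>T. T \<subseteq> S \<and> T \<noteq> {} \<longrightarrow> T \<in> \<S>)"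

definition admissible :: "nat \<Rightarrow> 'a oriented_complex \<Rightarrow> bool" where
  "admissible d K \<longleftrightarrow>
     simplicial_complex (simplices K) \<and> finite (simplices K) \<and>
     (\<forall>S\<in>simplices K. \<exists>F\<in>facets d K. S \<subseteq> F) \<and>
     (\<forall>F\<in>oriented_facets K. distinct F) \<and>
     bij_betw set (oriented_facets K) (facets d K) \<and>
     (\<forall>ys. (\<Sum>F\<in>oriented_facets K. simplex_boundary F ys :: int) = 0)"

definition facet_chain :: "'a oriented_complex \<Rightarrow> ('a, 'r::linordered_idom) chain" where
  "facet_chain K = (\<lambda>ys. \<Sum>F\<in>oriented_facets K. oriented_simplex F ys)"

text \<open>The coefficient ring is the result type: \<^typ>\<open>int\<close> or \<^typ>\<open>rat\<close>.\<close>

definition filling_volume :: "nat \<Rightarrow> 'a oriented_complex \<Rightarrow> 'r::linordered_idom" where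
  "filling_volume d K =
     (LEAST m. \<exists>\<alpha>\<in>chains (d + 1) (vertices K). boundary \<alpha> = facet_chain K \<and> m = chain_norm \<alpha>)"

definition disjoint_union ::
    "'a oriented_complex \<Rightarrow> 'b oriented_complex \<Rightarrow> ('a + 'b) oriented_complex"
    (infixl \<open>\<squnion>\<^sub>c\<close> 65) where
  "K \<squnion>\<^sub>c K' =
     \<lparr>simplices = image Inl ` simplices K \<union> image Inr ` simplices K',
      oriented_facets = map Inl ` oriented_facets K \<union> map Inr ` oriented_facets K'\<rparr>"

end

theory Submission
  imports Defs "HOL-Combinatorics.Multiset_Permutations" "Jordan_Normal_Form.Determinant"
begin

text \<open>
  Fillings of \<open>K\<close> and of \<open>K'\<close> add up to a filling of the disjoint union, so its volume is at most the
  sum (\<open>filling_disjoint_union\<close>). For the other inequality (\<open>filling_volume_superadditive\<close>) let \<open>\<alpha>\<close>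
  fill the disjoint union. The vertex map \<open>f\<close> that is the identity on \<open>K\<close> and collapses all of \<open>K'\<close> to
  one vertex of \<open>K\<close> sends every facet of \<open>K'\<close> to a degenerate simplex, because \<open>d \<ge> 1\<close>; hence \<open>f\<close>
  maps \<open>\<alpha>\<close> to a filling of \<open>K\<close>. The opposite collapse \<open>g\<close> maps \<open>\<alpha>\<close> to a filling of \<open>K'\<close>. A simplex
  that survives \<open>f\<close> has at most one vertex in \<open>K'\<close>, and one that survives \<open>g\<close> has at most one vertex
  in \<open>K\<close>. A \<open>(d + 1)\<close>-simplex has \<open>d + 2 > 2\<close> vertices and cannot survive both. So the two image
  fillings arise from disjoint parts of \<open>\<alpha>\<close>, and their norms add up to at most that of \<open>\<alpha>\<close>.

  The calculations avoid choosing orientations. For a chain \<open>\<alpha>\<close> on a finite vertex set \<open>V\<close>, the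
  boundary is \<open>ys \<mapsto> \<Sum>v\<in>V. \<alpha> (v # ys)\<close> (\<open>boundary_eq_sum_Cons\<close>), and \<open>(n + 1)!\<close> times the norm is the
  sum of \<open>\<bar>\<alpha> xs\<bar>\<close> over all vertex lists of length \<open>n + 1\<close> (\<open>fact_mult_chain_norm\<close>). The image of \<open>\<alpha>\<close>
  under \<open>f\<close> sums \<open>\<alpha>\<close> over the fibres of \<open>map f\<close>; compatibility with the boundary
  (\<open>boundary_pushforward\<close>) is then a rearrangement of finite sums. The boundary formula for a single
  simplex is a Laplace expansion, since the coefficients of an oriented simplex are determinants
  (\<open>oriented_simplex_det\<close>).

  A filling of least norm exists because norms of integral chains are nonnegative integers and the
  cone over \<open>K\<close> from one of its vertices is a filling (\<open>cone_filling\<close>). A complex without vertices has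
  neither a cone nor a target for the collapse, but it is filled by the zero chain.
\<close>

section \<open>Oriented simplices as determinants\<close>

text \<open>The list without its \<open>i\<close>-th entry, counting from zero.\<close>

abbreviation omit :: "nat \<Rightarrow> 'a list \<Rightarrow> 'a list" where
  "omit i xs \<equiv> take i xs @ drop (Suc i) xs"

lemma nth_omit:
  assumes "i < length xs" "j < length xs - 1"
  shows "omit i xs ! j = xs ! (if j < i then j else Suc j)"
  using assms by (auto simp: nth_append min_def)

lemma oriented_simplex_length_neq:
  "length xs \<noteq> length ys \<Longrightarrow> (oriented_simplex xs ys :: 'r::linordered_idom) = 0"
  unfolding oriented_simplex_def by (rule sum.neutral) auto

lemma oriented_simplex_det:
  assumes n: "length xs = n" "length ys = n"
  shows "(oriented_simplex xs ys :: 'r::linordered_idom) =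
    det (mat n n (\<lambda>(i, j). of_bool (ys ! i = xs ! j)))"
proof -
  let ?P = "{p. p permutes {..<n}}"
  have *: "(\<Prod>i = 0..<n. mat n n (\<lambda>(i, j). of_bool (ys ! i = xs ! j)) $$ (i, p i)) =
      (of_bool (permute_list p xs = ys) :: 'r)" if p: "p permutes {..<n}" for p
  proof -
    have pi: "p i < n" if "i < n" for i using permutes_in_image[OF p, of i] that by simp
    have "(\<Prod>i = 0..<n. mat n n (\<lambda>(i, j). of_bool (ys ! i = xs ! j)) $$ (i, p i)) =
        (\<Prod>i = 0..<n. of_bool (ys ! i = xs ! p i) :: 'r)"
      by (rule prod.cong) (auto simp: pi)
    also have "\<dots> = of_bool (\<forall>i<n. ys ! i = xs ! p i)"
      by (auto intro!: prod.neutral simp: Ball_def)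
    also have "(\<forall>i<n. ys ! i = xs ! p i) \<longleftrightarrow> permute_list p xs = ys"
      using n p by (auto simp: list_eq_iff_nth_eq permute_list_nth)
    finally show ?thesis .
  qed
  have "(oriented_simplex xs ys :: 'r) =
      (\<Sum>p\<in>?P. if permute_list p xs = ys then of_int (sign p) else 0)"
    unfolding oriented_simplex_def n(1)
    by (subst sum.inter_filter[symmetric]) (auto simp: finite_permutations)
  also have "\<dots> = (\<Sum>p\<in>?P. of_int (sign p) *
      (\<Prod>i = 0..<n. mat n n (\<lambda>(i, j). of_bool (ys ! i = xs ! j)) $$ (i, p i)))"
    by (rule sum.cong) (auto simp: *)
  also have "\<dots> = det (mat n n (\<lambda>(i, j). of_bool (ys ! i = xs ! j)))"
    by (simp add: det_def' [of _ n] atLeast0LessThan)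
  finally show ?thesis .
qed

text \<open>Laplace expansion along the row of the prepended vertex.\<close>

lemma oriented_simplex_Cons_right:
  "(oriented_simplex xs (v # ys) :: 'r::linordered_idom) =
    (\<Sum>i<length xs. if xs ! i = v then (-1) ^ i * oriented_simplex (omit i xs) ys else 0)"
proof (cases "length xs = Suc (length ys)")
  case True
  define n where "n = length ys"
  have xs: "length xs = Suc n" using True by (simp add: n_def)
  let ?A = "mat (Suc n) (Suc n) (\<lambda>(i, j). of_bool ((v # ys) ! i = xs ! j)) :: 'r mat"
  have del: "mat_delete ?A 0 j = mat n n (\<lambda>(i, k). of_bool (ys ! i = omit j xs ! k))"
    if "j < Suc n" for j
    by (rule eq_matI) (use that xs in \<open>auto simp: mat_delete_def nth_omit simp del: nth_append\<close>)
  have "(oriented_simplex xs (v # ys) :: 'r) = det ?A"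
    by (rule oriented_simplex_det) (auto simp: xs n_def)
  also have "\<dots> = (\<Sum>j<Suc n. ?A $$ (0, j) * cofactor ?A 0 j)"
    by (rule laplace_expansion_row) auto
  also have "\<dots> = (\<Sum>j<Suc n. if xs ! j = v then (-1) ^ j * oriented_simplex (omit j xs) ys else 0)"
    by (rule sum.cong)
      (auto simp: cofactor_def del xs n_def[symmetric] oriented_simplex_det[where n = n])
  finally show ?thesis by (simp add: xs)
next
  case False
  then show ?thesis
    by (auto simp: oriented_simplex_length_neq intro!: sum.neutral)
qed

text \<open>Laplace expansion along the column of the prepended vertex.\<close>

lemma oriented_simplex_Cons_left:
  "(oriented_simplex (v # xs) ys :: 'r::linordered_idom) =
    (\<Sum>i<length ys. if ys ! i = v then (-1) ^ i * oriented_simplex xs (omit i ys) else 0)"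
proof (cases "length ys = Suc (length xs)")
  case True
  define n where "n = length xs"
  have ys: "length ys = Suc n" using True by (simp add: n_def)
  let ?A = "mat (Suc n) (Suc n) (\<lambda>(i, j). of_bool (ys ! i = (v # xs) ! j)) :: 'r mat"
  have del: "mat_delete ?A i 0 = mat n n (\<lambda>(k, j). of_bool (omit i ys ! k = xs ! j))"
    if "i < Suc n" for i
    by (rule eq_matI) (use that ys in \<open>auto simp: mat_delete_def nth_omit simp del: nth_append\<close>)
  have "(oriented_simplex (v # xs) ys :: 'r) = det ?A"
    by (rule oriented_simplex_det) (auto simp: ys n_def)
  also have "\<dots> = (\<Sum>i<Suc n. ?A $$ (i, 0) * cofactor ?A i 0)"
    by (rule laplace_expansion_column) auto
  also have "\<dots> = (\<Sum>i<Suc n. if ys ! i = v then (-1) ^ i * oriented_simplex xs (omit i ys) else 0)"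
    by (rule sum.cong)
      (auto simp: cofactor_def del ys n_def[symmetric] oriented_simplex_det[where n = n])
  finally show ?thesis by (simp add: ys)
next
  case False
  then show ?thesis
    by (auto simp: oriented_simplex_length_neq intro!: sum.neutral)
qed

lemma oriented_simplex_permute:
  assumes p: "p permutes {..<length ys}"
  shows "(oriented_simplex xs (permute_list p ys) :: 'r::linordered_idom) =
    of_int (sign p) * oriented_simplex xs ys"
proof (cases "length xs = length ys")
  case True
  let ?n = "length ys"
  let ?A = "mat ?n ?n (\<lambda>(i, j). of_bool (ys ! i = xs ! j)) :: 'r mat"
  have pi: "p i < ?n" if "i < ?n" for i using permutes_in_image[OF p, of i] that by simp
  have "(oriented_simplex xs (permute_list p ys) :: 'r) =
      det (mat ?n ?n (\<lambda>(i, j). of_bool (permute_list p ys ! i = xs ! j)))"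
    by (rule oriented_simplex_det) (auto simp: True)
  also have "mat ?n ?n (\<lambda>(i, j). of_bool (permute_list p ys ! i = xs ! j)) =
      mat ?n ?n (\<lambda>(i, j). ?A $$ (p i, j))"
    by (rule eq_matI) (auto simp: permute_list_nth[OF p] pi)
  also have "det \<dots> = of_int (sign p) * det ?A"
    by (rule det_permute_rows) (use p in \<open>auto simp: atLeast0LessThan\<close>)
  also have "det ?A = oriented_simplex xs ys"
    by (rule oriented_simplex_det[symmetric]) (auto simp: True)
  finally show ?thesis .
qed (auto simp: oriented_simplex_length_neq)


section \<open>Alternating functions and chains\<close>

lemma alternating_eq_0:
  fixes \<alpha> :: "'a list \<Rightarrow> 'r::linordered_idom"
  assumes alt: "\<And>p. p permutes {..<length xs} \<Longrightarrow> \<alpha> (permute_list p xs) = of_int (sign p) * \<alpha> xs"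
    and "\<not> distinct xs"
  shows "\<alpha> xs = 0"
proof -
  obtain i j where ij: "i < length xs" "j < length xs" "i \<noteq> j" "xs ! i = xs ! j"
    using assms(2) by (auto simp: distinct_conv_nth)
  let ?p = "Transposition.transpose i j"
  have p: "?p permutes {..<length xs}" using ij by (intro permutes_swap_id) auto
  have "permute_list ?p xs = xs"
    using ij by (intro nth_equalityI) (auto simp: permute_list_nth[OF p] transpose_def)
  then have "\<alpha> xs = - \<alpha> xs" using alt[OF p] ij by (simp add: sign_swap_id)
  then show ?thesis by simp
qed

lemma chainsI:
  fixes \<alpha> :: "('a, 'r::linordered_idom) chain"
  assumes "\<And>xs. \<alpha> xs \<noteq> 0 \<Longrightarrow> length xs = n + 1 \<and> set xs \<subseteq> V"
    and "\<And>xs p. p permutes {..<length xs} \<Longrightarrow> \<alpha> (permute_list p xs) = of_int (sign p) * \<alpha> xs"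
  shows "\<alpha> \<in> chains n V"
  unfolding chains_def using assms alternating_eq_0[of _ \<alpha>] by blast

lemma chainsD:
  assumes "\<alpha> \<in> chains n V"
  shows "\<alpha> xs \<noteq> 0 \<Longrightarrow> distinct xs" "\<alpha> xs \<noteq> 0 \<Longrightarrow> length xs = n + 1" "\<alpha> xs \<noteq> 0 \<Longrightarrow> set xs \<subseteq> V"
    "p permutes {..<length xs} \<Longrightarrow> \<alpha> (permute_list p xs) = of_int (sign p) * \<alpha> xs"
  using assms unfolding chains_def by blast+

lemma chains_add:
  assumes "\<alpha> \<in> chains n V" "\<beta> \<in> chains n V"
  shows "(\<lambda>xs. \<alpha> xs + \<beta> xs) \<in> chains n V"
proof (rule chainsI)
  fix xs assume "\<alpha> xs + \<beta> xs \<noteq> 0"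
  then have "\<alpha> xs \<noteq> 0 \<or> \<beta> xs \<noteq> 0" by auto
  then show "length xs = n + 1 \<and> set xs \<subseteq> V" using assms chainsD(2,3) by blast
qed (simp add: chainsD(4)[OF assms(1)] chainsD(4)[OF assms(2)] algebra_simps)

lemma chains_sum:
  assumes "\<And>i. i \<in> I \<Longrightarrow> \<alpha> i \<in> chains n V"
  shows "(\<lambda>xs. \<Sum>i\<in>I. \<alpha> i xs) \<in> chains n V"
proof (rule chainsI)
  fix xs assume "(\<Sum>i\<in>I. \<alpha> i xs) \<noteq> 0"
  then obtain i where "i \<in> I" "\<alpha> i xs \<noteq> 0" by (meson sum.neutral)
  then show "length xs = n + 1 \<and> set xs \<subseteq> V" using assms chainsD(2,3) by blast
qed (auto simp: sum_distrib_left intro!: sum.cong chainsD(4) assms)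

lemma oriented_simplex_chains:
  assumes "length xs = n + 1" "set xs \<subseteq> V"
  shows "oriented_simplex xs \<in> chains n V"
proof (rule chainsI)
  fix ys assume "oriented_simplex xs ys \<noteq> (0 :: 'b)"
  then obtain p where "p permutes {..<length xs}" "permute_list p xs = ys"
    unfolding oriented_simplex_def by (metis (mono_tags, lifting) mem_Collect_eq sum.neutral)
  then show "length ys = n + 1 \<and> set ys \<subseteq> V" using assms by auto
qed (rule oriented_simplex_permute)

lemma oriented_simplex_not_distinct:
  assumes "\<not> distinct xs"
  shows "(oriented_simplex xs ys :: 'r::linordered_idom) = 0"
proof (rule ccontr)
  assume nz: "oriented_simplex xs ys \<noteq> (0 :: 'r)"
  then obtain p where "p permutes {..<length xs}" "permute_list p xs = ys"
    unfolding oriented_simplex_def by (metis (mono_tags, lifting) mem_Collect_eq sum.neutral)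
  then have "\<not> distinct ys" using assms by auto
  then have "oriented_simplex xs ys = (0 :: 'r)"
    by (intro alternating_eq_0 oriented_simplex_permute)
  with nz show False by simp
qed

lemma oriented_simplex_eq_0:
  assumes "set xs \<noteq> set ys"
  shows "(oriented_simplex xs ys :: 'r::linordered_idom) = 0"
  unfolding oriented_simplex_def by (rule sum.neutral) (use assms in auto)

lemma oriented_simplex_permute_list:
  assumes "distinct xs" and p: "p permutes {..<length xs}"
  shows "(oriented_simplex xs (permute_list p xs) :: 'r::linordered_idom) = of_int (sign p)"
proof -
  have "q = p" if q: "q permutes {..<length xs}" and eq: "permute_list q xs = permute_list p xs" for q
  proof
    fix i
    show "q i = p i"
    proof (cases "i < length xs")
      case True
      then have "xs ! q i = xs ! p i" using eq by (metis p permute_list_nth q)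
      then show ?thesis
        using assms(1) permutes_in_image[OF p, of i] permutes_in_image[OF q, of i] True
        by (simp add: nth_eq_iff_index_eq)
    next
      case False
      then show ?thesis using p q by (simp add: permutes_not_in)
    qed
  qed
  then have "{q. q permutes {..<length xs} \<and> permute_list q xs = permute_list p xs} = {p}"
    using p by blast
  then show ?thesis by (simp add: oriented_simplex_def)
qed

lemma chosen_order:
  assumes "finite S"
  shows "distinct (chosen_order S)" "set (chosen_order S) = S"
  using someI_ex[of "\<lambda>xs. distinct xs \<and> set xs = S"] finite_distinct_list[OF assms]
  unfolding chosen_order_def by blast+

lemma chain_support_chains:
  assumes "\<alpha> \<in> chains n V" "S \<in> chain_support \<alpha>"
  shows "finite S" "S \<subseteq> V" "card S = n + 1"
proof -
  obtain xs where xs: "\<alpha> xs \<noteq> 0" "S = set xs"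
    using assms(2) by (auto simp: chain_support_def)
  show "finite S" "S \<subseteq> V" "card S = n + 1"
    using chainsD(1-3)[OF assms(1) xs(1)] by (simp_all add: xs(2) distinct_card)
qed

lemma finite_chain_support:
  assumes "finite V" "\<alpha> \<in> chains n V"
  shows "finite (chain_support \<alpha>)"
  using chain_support_chains(2)[OF assms(2)] assms(1)
  by (auto intro!: finite_subset[of "chain_support \<alpha>" "Pow V"])

lemma distinct_set_eq_permutation:
  assumes "distinct xs" "distinct ys" "set xs = set ys"
  obtains p where "p permutes {..<length xs}" "permute_list p xs = ys"
proof -
  have "mset ys = mset xs" using assms by (metis set_eq_iff_mset_eq_distinct)
  then show ?thesis using mset_eq_permutation that by blast
qed

text \<open>A chain is the combination of oriented simplices, one for each simplex in its support.\<close>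

lemma chain_expansion:
  fixes \<alpha> :: "('a, 'r::linordered_idom) chain"
  assumes V: "finite V" and \<alpha>: "\<alpha> \<in> chains n V"
  shows "\<alpha> xs = (\<Sum>S\<in>chain_support \<alpha>. \<alpha> (chosen_order S) * oriented_simplex (chosen_order S) xs)"
proof -
  note fin = finite_chain_support[OF V \<alpha>]
  have set_co: "set (chosen_order S) = S" if "S \<in> chain_support \<alpha>" for S
    using chosen_order(2) chain_support_chains(1)[OF \<alpha> that] by blast
  show ?thesis
  proof (cases "set xs \<in> chain_support \<alpha>")
    case True
    let ?co = "chosen_order (set xs)"
    have "(\<Sum>S\<in>chain_support \<alpha>. \<alpha> (chosen_order S) * oriented_simplex (chosen_order S) xs) =
        (\<Sum>S\<in>{set xs}. \<alpha> (chosen_order S) * oriented_simplex (chosen_order S) xs)"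
      by (rule sum.mono_neutral_right[OF fin]) (use True set_co in \<open>auto simp: oriented_simplex_eq_0\<close>)
    also have "\<dots> = \<alpha> ?co * oriented_simplex ?co xs" by simp
    also have "\<dots> = \<alpha> xs"
    proof (cases "distinct xs")
      case dist: True
      obtain p where p: "p permutes {..<length ?co}" "permute_list p ?co = xs"
        using distinct_set_eq_permutation[of ?co xs] chosen_order[of "set xs"] dist by auto
      have "oriented_simplex ?co xs = (of_int (sign p) :: 'r)"
        using oriented_simplex_permute_list[OF chosen_order(1) p(1)] p(2) by simp
      moreover have "\<alpha> xs = of_int (sign p) * \<alpha> ?co"
        using chainsD(4)[OF \<alpha> p(1)] p(2) by simp
      ultimately show ?thesis by (simp add: mult.commute)
    next
      case False
      then have "oriented_simplex ?co xs = (0 :: 'r)"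
        by (intro alternating_eq_0 oriented_simplex_permute)
      moreover have "\<alpha> xs = 0" using False chainsD(1)[OF \<alpha>] by blast
      ultimately show ?thesis by simp
    qed
    finally show ?thesis ..
  next
    case False
    then have "\<alpha> xs = 0" by (auto simp: chain_support_def)
    moreover have "oriented_simplex (chosen_order S) xs = (0 :: 'r)" if "S \<in> chain_support \<alpha>" for S
      using False that set_co by (intro oriented_simplex_eq_0) auto
    ultimately show ?thesis by simp
  qed
qed

lemma simplex_boundary_eq_sum_Cons:
  assumes "finite V" "set xs \<subseteq> V"
  shows "(simplex_boundary xs ys :: 'r::linordered_idom) = (\<Sum>v\<in>V. oriented_simplex xs (v # ys))"
proof -
  have "(\<Sum>v\<in>V. oriented_simplex xs (v # ys)) = (\<Sum>i<length xs. \<Sum>v\<in>V.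
      if xs ! i = v then (-1) ^ i * (oriented_simplex (omit i xs) ys :: 'r) else 0)"
    by (subst sum.swap) (simp add: oriented_simplex_Cons_right)
  also have "\<dots> = simplex_boundary xs ys"
    unfolding simplex_boundary_def
    by (rule sum.cong) (use assms nth_mem in \<open>auto simp: sum.delta\<close>)
  finally show ?thesis ..
qed

text \<open>
  The coefficient of a face \<open>ys\<close> in the boundary collects all simplices obtained by adding a vertex
  in front of \<open>ys\<close>.
\<close>

lemma boundary_eq_sum_Cons:
  fixes \<alpha> :: "('a, 'r::linordered_idom) chain"
  assumes V: "finite V" and \<alpha>: "\<alpha> \<in> chains n V"
  shows "boundary \<alpha> ys = (\<Sum>v\<in>V. \<alpha> (v # ys))"
proof -
  have "boundary \<alpha> ys = (\<Sum>S\<in>chain_support \<alpha>. \<Sum>v\<in>V.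
      \<alpha> (chosen_order S) * oriented_simplex (chosen_order S) (v # ys))"
    unfolding boundary_def
  proof (rule sum.cong[OF refl])
    fix S assume "S \<in> chain_support \<alpha>"
    note S = chain_support_chains(1,2)[OF \<alpha> this]
    have "set (chosen_order S) \<subseteq> V"
      using S by (simp add: chosen_order(2))
    then show "\<alpha> (chosen_order S) * simplex_boundary (chosen_order S) ys =
        (\<Sum>v\<in>V. \<alpha> (chosen_order S) * oriented_simplex (chosen_order S) (v # ys))"
      by (simp only: simplex_boundary_eq_sum_Cons[OF V] sum_distrib_left)
  qed
  also have "\<dots> = (\<Sum>v\<in>V. \<Sum>S\<in>chain_support \<alpha>.
      \<alpha> (chosen_order S) * oriented_simplex (chosen_order S) (v # ys))"
    by (rule sum.swap)
  also have "\<dots> = (\<Sum>v\<in>V. \<alpha> (v # ys))"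
    by (simp only: chain_expansion[OF V \<alpha>, symmetric])
  finally show ?thesis .
qed

abbreviation vertex_lists :: "nat \<Rightarrow> 'a set \<Rightarrow> 'a list set" where
  "vertex_lists n V \<equiv> {xs. set xs \<subseteq> V \<and> length xs = n}"

text \<open>Every \<open>n\<close>-simplex has \<open>(n + 1)!\<close> orderings, on which \<open>\<alpha>\<close> agrees up to sign.\<close>

lemma fact_mult_chain_norm:
  fixes \<alpha> :: "('a, 'r::linordered_idom) chain"
  assumes V: "finite V" and \<alpha>: "\<alpha> \<in> chains n V"
  shows "fact (n + 1) * chain_norm \<alpha> = (\<Sum>xs\<in>vertex_lists (n + 1) V. \<bar>\<alpha> xs\<bar>)"
proof -
  note fin = finite_chain_support[OF V \<alpha>]
  let ?U = "\<Union>S\<in>chain_support \<alpha>. permutations_of_set S"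
  have abs_eq: "\<bar>\<alpha> xs\<bar> = \<bar>\<alpha> (chosen_order S)\<bar>"
    if S: "finite S" and "xs \<in> permutations_of_set S" for S xs
  proof -
    have xs: "distinct xs" "set xs = S" using that(2) by (auto simp: permutations_of_set_def)
    obtain p where "p permutes {..<length (chosen_order S)}" "permute_list p (chosen_order S) = xs"
      using distinct_set_eq_permutation[of "chosen_order S" xs] chosen_order[OF S] xs by auto
    then have "\<alpha> xs = of_int (sign p) * \<alpha> (chosen_order S)"
      using chainsD(4)[OF \<alpha>] by blast
    then show ?thesis by (auto simp: sign_def abs_mult)
  qed
  have "(\<Sum>xs\<in>vertex_lists (n + 1) V. \<bar>\<alpha> xs\<bar>) = (\<Sum>xs\<in>?U. \<bar>\<alpha> xs\<bar>)"
  proof (rule sum.mono_neutral_right)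
    show "finite (vertex_lists (n + 1) V)" by (rule finite_lists_length_eq[OF V])
    show "?U \<subseteq> vertex_lists (n + 1) V"
      using chain_support_chains[OF \<alpha>] by (force simp: permutations_of_set_def distinct_card[symmetric])
    show "\<forall>xs\<in>vertex_lists (n + 1) V - ?U. \<bar>\<alpha> xs\<bar> = 0"
      using chainsD(1)[OF \<alpha>] by (auto simp: permutations_of_set_def chain_support_def)
  qed
  also have "\<dots> = (\<Sum>S\<in>chain_support \<alpha>. \<Sum>xs\<in>permutations_of_set S. \<bar>\<alpha> xs\<bar>)"
  proof (rule sum.UNION_disjoint[OF fin])
    show "\<forall>S\<in>chain_support \<alpha>. finite (permutations_of_set S)" by simp
  qed (auto simp: permutations_of_set_def)
  also have "\<dots> = (\<Sum>S\<in>chain_support \<alpha>. fact (n + 1) * \<bar>\<alpha> (chosen_order S)\<bar>)"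
  proof (rule sum.cong[OF refl])
    fix S assume "S \<in> chain_support \<alpha>"
    note S = chain_support_chains[OF \<alpha> this]
    have "(\<Sum>xs\<in>permutations_of_set S. \<bar>\<alpha> xs\<bar>) = (\<Sum>xs\<in>permutations_of_set S. \<bar>\<alpha> (chosen_order S)\<bar>)"
      by (rule sum.cong[OF refl]) (rule abs_eq[OF S(1)])
    also have "\<dots> = fact (n + 1) * \<bar>\<alpha> (chosen_order S)\<bar>"
      using S(1,3) by (simp del: fact_Suc)
    finally show "(\<Sum>xs\<in>permutations_of_set S. \<bar>\<alpha> xs\<bar>) = fact (n + 1) * \<bar>\<alpha> (chosen_order S)\<bar>" .
  qed
  finally show ?thesis by (simp add: chain_norm_def sum_distrib_left)
qed

lemma chain_norm_nonneg: "chain_norm \<alpha> \<ge> 0"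
  unfolding chain_norm_def by (simp add: sum_nonneg)


section \<open>Pushing chains forward along vertex maps\<close>

text \<open>
  The image of a chain on the vertex set \<open>W\<close> under a vertex map. The coefficient of \<open>ys\<close> sums \<open>\<alpha>\<close> over
  the lists in \<open>W\<close> lying over \<open>ys\<close>. No case distinction for degenerate images is needed: if \<open>ys\<close> has a
  repeated entry, swapping the corresponding positions makes the sum cancel.
\<close>

definition pushforward ::
    "('a \<Rightarrow> 'b) \<Rightarrow> 'a set \<Rightarrow> ('a, 'r::linordered_idom) chain \<Rightarrow> ('b, 'r) chain" where
  "pushforward f W \<alpha> = (\<lambda>ys. \<Sum>xs | set xs \<subseteq> W \<and> map f xs = ys. \<alpha> xs)"

lemma finite_preimage_lists: "finite W \<Longrightarrow> finite {xs. set xs \<subseteq> W \<and> map f xs = ys}"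
  by (rule finite_subset[OF _ finite_lists_length_eq[of W "length ys"]]) auto

lemma permute_list_inv:
  assumes p: "p permutes {..<length xs}"
  shows "permute_list p (permute_list (Hilbert_Choice.inv p) xs) = xs"
    and "permute_list (Hilbert_Choice.inv p) (permute_list p xs) = xs"
  using permute_list_compose[OF p, of "Hilbert_Choice.inv p"]
    permute_list_compose[OF permutes_inv[OF p], of p]
  unfolding permutes_inv_o[OF p] by simp_all

lemma pushforward_permute:
  fixes \<alpha> :: "('a, 'r::linordered_idom) chain"
  assumes \<alpha>: "\<alpha> \<in> chains n W" and p: "p permutes {..<length ys}"
  shows "pushforward f W \<alpha> (permute_list p ys) = of_int (sign p) * pushforward f W \<alpha> ys"
proof -
  let ?q = "Hilbert_Choice.inv p"
  have q: "?q permutes {..<length ys}" by (rule permutes_inv[OF p])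
  have "pushforward f W \<alpha> (permute_list p ys) =
      (\<Sum>xs | set xs \<subseteq> W \<and> map f xs = ys. \<alpha> (permute_list p xs))"
    unfolding pushforward_def
  proof (rule sum.reindex_bij_witness[of _ "permute_list p" "permute_list ?q"])
    fix xs assume xs: "xs \<in> {xs. set xs \<subseteq> W \<and> map f xs = permute_list p ys}"
    then have eq: "map f xs = permute_list p ys" by simp
    from arg_cong[OF eq, of length] have len: "length xs = length ys" by simp
    show inv: "permute_list p (permute_list ?q xs) = xs"
      by (rule permute_list_inv) (simp add: len p)
    show "\<alpha> (permute_list p (permute_list ?q xs)) = \<alpha> xs" by (simp only: inv)
    have "map f (permute_list ?q xs) = permute_list ?q (map f xs)"
      by (rule permute_list_map[symmetric]) (simp add: len q)
    also have "\<dots> = ys" unfolding eq by (rule permute_list_inv(2)[OF p])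
    finally show "permute_list ?q xs \<in> {xs. set xs \<subseteq> W \<and> map f xs = ys}"
      using xs len q by simp
  next
    fix xs assume xs: "xs \<in> {xs. set xs \<subseteq> W \<and> map f xs = ys}"
    then have len: "length xs = length ys" by auto
    show "permute_list ?q (permute_list p xs) = xs"
      by (rule permute_list_inv) (simp add: len p)
    show "permute_list p xs \<in> {xs. set xs \<subseteq> W \<and> map f xs = permute_list p ys}"
      using xs len p permute_list_map[of p xs f] by simp
  qed
  also have "\<dots> = (\<Sum>xs | set xs \<subseteq> W \<and> map f xs = ys. of_int (sign p) * \<alpha> xs)"
    by (rule sum.cong[OF refl], rule chainsD(4)[OF \<alpha>]) (use p in auto)
  finally show ?thesis by (simp add: pushforward_def sum_distrib_left)
qed

lemma pushforward_chains:
  fixes \<alpha> :: "('a, 'r::linordered_idom) chain"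
  assumes \<alpha>: "\<alpha> \<in> chains n W" and f: "f ` W \<subseteq> V"
  shows "pushforward f W \<alpha> \<in> chains n V"
proof (rule chainsI)
  fix ys assume "pushforward f W \<alpha> ys \<noteq> 0"
  then obtain xs where "set xs \<subseteq> W" "map f xs = ys" "\<alpha> xs \<noteq> 0"
    unfolding pushforward_def by (metis (mono_tags, lifting) mem_Collect_eq sum.neutral)
  then show "length ys = n + 1 \<and> set ys \<subseteq> V"
    using chainsD(2)[OF \<alpha> \<open>\<alpha> xs \<noteq> 0\<close>] f by (auto simp: image_subset_iff subset_iff)
qed (rule pushforward_permute[OF \<alpha>])

lemma boundary_pushforward:
  fixes \<alpha> :: "('a, 'r::linordered_idom) chain"
  assumes W: "finite W" and V: "finite V" and \<alpha>: "\<alpha> \<in> chains n W" and f: "f ` W \<subseteq> V"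
  shows "boundary (pushforward f W \<alpha>) = pushforward f W (boundary \<alpha>)"
proof
  fix ys
  have "boundary (pushforward f W \<alpha>) ys =
      (\<Sum>v\<in>V. \<Sum>xs | set xs \<subseteq> W \<and> map f xs = v # ys. \<alpha> xs)"
    by (simp only: boundary_eq_sum_Cons[OF V pushforward_chains[OF \<alpha> f]]) (simp only: pushforward_def)
  also have "\<dots> = (\<Sum>(v, xs)\<in>(SIGMA v:V. {xs. set xs \<subseteq> W \<and> map f xs = v # ys}). \<alpha> xs)"
    by (rule sum.Sigma) (use V W finite_preimage_lists in auto)
  \<comment> \<open>A list over \<open>v # ys\<close> is a list over \<open>ys\<close> with a vertex over \<open>v\<close> in front; the range
      \<open>V\<close> of \<open>v\<close> contains all values of \<open>f\<close>, so that vertex is arbitrary in \<open>W\<close>.\<close>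
  also have "\<dots> = (\<Sum>(xs, w)\<in>{xs. set xs \<subseteq> W \<and> map f xs = ys} \<times> W. \<alpha> (w # xs))"
    by (rule sum.reindex_bij_witness[of _ "\<lambda>(xs, w). (f w, w # xs)" "\<lambda>(v, xs). (tl xs, hd xs)"])
      (use f in auto)
  also have "\<dots> = (\<Sum>xs | set xs \<subseteq> W \<and> map f xs = ys. \<Sum>w\<in>W. \<alpha> (w # xs))"
    by (rule sum.cartesian_product[symmetric])
  also have "\<dots> = pushforward f W (boundary \<alpha>) ys"
    by (simp only: boundary_eq_sum_Cons[OF W \<alpha>] pushforward_def)
  finally show "boundary (pushforward f W \<alpha>) ys = pushforward f W (boundary \<alpha>) ys" .
qed

text \<open>If \<open>f\<close> identifies vertices of \<open>xs\<close>, both sides are zero.\<close>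

lemma pushforward_oriented_simplex:
  assumes W: "finite W" and xs: "set xs \<subseteq> W"
  shows "pushforward f W (oriented_simplex xs) =
    (oriented_simplex (map f xs) :: ('b, 'r::linordered_idom) chain)"
proof
  fix ys
  let ?P = "\<lambda>zs. {p. p permutes {..<length xs} \<and> permute_list p xs = zs}"
  have "pushforward f W (oriented_simplex xs) ys =
      (\<Sum>zs | set zs \<subseteq> W \<and> map f zs = ys. \<Sum>p\<in>?P zs. (of_int (sign p) :: 'r))"
    unfolding pushforward_def oriented_simplex_def ..
  also have "\<dots> = (\<Sum>p\<in>(\<Union>zs\<in>{zs. set zs \<subseteq> W \<and> map f zs = ys}. ?P zs). of_int (sign p))"
    by (rule sum.UNION_disjoint[symmetric])
      (use W in \<open>auto simp: finite_preimage_lists intro: finite_subset[OF _ finite_permutations]\<close>)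
  also have "(\<Union>zs\<in>{zs. set zs \<subseteq> W \<and> map f zs = ys}. ?P zs) =
      {p. p permutes {..<length (map f xs)} \<and> permute_list p (map f xs) = ys}"
    using xs by (auto simp: permute_list_map)
  finally show "pushforward f W (oriented_simplex xs) ys = (oriented_simplex (map f xs) ys :: 'r)"
    by (simp add: oriented_simplex_def)
qed

lemma pushforward_sum:
  "pushforward f W (\<lambda>xs. \<Sum>i\<in>I. \<alpha> i xs) ys = (\<Sum>i\<in>I. pushforward f W (\<alpha> i) ys)"
  unfolding pushforward_def by (rule sum.swap)

lemma pushforward_add:
  "pushforward f W (\<lambda>xs. \<alpha> xs + \<beta> xs) ys = pushforward f W \<alpha> ys + pushforward f W \<beta> ys"
  unfolding pushforward_def by (rule sum.distrib)

text \<open>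
  For \<open>m = n + 1\<close> the left-hand side is \<open>m!\<close> times the norm of the image; it is bounded by the
  contribution of those simplices on which \<open>f\<close> is injective.
\<close>

lemma sum_abs_pushforward_le:
  fixes \<alpha> :: "('a, 'r::linordered_idom) chain"
  assumes W: "finite W" and V: "finite V" and \<alpha>: "\<alpha> \<in> chains n W" and f: "f ` W \<subseteq> V"
  shows "(\<Sum>ys\<in>vertex_lists m V. \<bar>pushforward f W \<alpha> ys\<bar>) \<le>
    (\<Sum>xs\<in>{xs \<in> vertex_lists m W. distinct (map f xs)}. \<bar>\<alpha> xs\<bar>)"
proof -
  let ?X = "{xs \<in> vertex_lists m W. distinct (map f xs)}"
  let ?Y = "{ys \<in> vertex_lists m V. distinct ys}"
  have fin: "finite (vertex_lists m V)" "finite (vertex_lists m W)"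
    using V W by (auto intro: finite_lists_length_eq)
  have "(\<Sum>ys\<in>vertex_lists m V. \<bar>pushforward f W \<alpha> ys\<bar>) = (\<Sum>ys\<in>?Y. \<bar>pushforward f W \<alpha> ys\<bar>)"
    by (rule sum.mono_neutral_right[OF fin(1)])
      (use chainsD(1)[OF pushforward_chains[OF \<alpha> f]] in auto)
  also have "\<dots> \<le> (\<Sum>ys\<in>?Y. \<Sum>xs | xs \<in> ?X \<and> map f xs = ys. \<bar>\<alpha> xs\<bar>)"
  proof (rule sum_mono)
    fix ys assume ys: "ys \<in> ?Y"
    then have "{xs. set xs \<subseteq> W \<and> map f xs = ys} = {xs. xs \<in> ?X \<and> map f xs = ys}" by auto
    then show "\<bar>pushforward f W \<alpha> ys\<bar> \<le> (\<Sum>xs | xs \<in> ?X \<and> map f xs = ys. \<bar>\<alpha> xs\<bar>)"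
      unfolding pushforward_def using sum_abs[of \<alpha>] by simp
  qed
  also have "\<dots> = (\<Sum>xs\<in>?X. \<bar>\<alpha> xs\<bar>)"
    by (rule sum.group)
      (use f in \<open>auto simp: image_subset_iff subset_iff
        intro: finite_subset[OF _ fin(1)] finite_subset[OF _ fin(2)]\<close>)
  finally show ?thesis .
qed


section \<open>Fillings\<close>

lemma admissible_finite_vertices: "admissible d K \<Longrightarrow> finite (vertices K)"
  unfolding admissible_def simplicial_complex_def vertices_def by auto

lemma admissible_facetD:
  assumes "admissible d K" "F \<in> oriented_facets K"
  shows "length F = d + 1" "set F \<subseteq> vertices K"
proof -
  have "set F \<in> facets d K" "distinct F"
    using assms unfolding admissible_def bij_betw_def by auto
  then show "length F = d + 1" "set F \<subseteq> vertices K"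
    by (auto simp: facets_def vertices_def distinct_card[symmetric])
qed

lemma admissible_finite_facets:
  assumes "admissible d K" shows "finite (oriented_facets K)"
proof -
  have "finite (facets d K)" using assms unfolding admissible_def facets_def by auto
  then show ?thesis using assms bij_betw_finite unfolding admissible_def by blast
qed

text \<open>Chains competing in the minimum that defines the filling volume.\<close>

definition filling :: "nat \<Rightarrow> 'a oriented_complex \<Rightarrow> ('a, 'r::linordered_idom) chain \<Rightarrow> bool" where
  "filling d K \<alpha> \<longleftrightarrow> \<alpha> \<in> chains (d + 1) (vertices K) \<and> boundary \<alpha> = facet_chain K"

text \<open>
  The cone from a vertex \<open>v\<close>: its boundary is \<open>K\<close> minus the cone over the boundary of \<open>K\<close>, which
  vanishes. Facets containing \<open>v\<close> contribute the zero chain.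
\<close>

lemma cone_filling:
  assumes K: "admissible d K" and v: "v \<in> vertices K"
  shows "filling d K (\<lambda>ys. \<Sum>F\<in>oriented_facets K. oriented_simplex (v # F) ys :: int)"
proof -
  let ?V = "vertices K" and ?\<Phi> = "oriented_facets K"
  let ?C = "\<lambda>ys. \<Sum>F\<in>?\<Phi>. oriented_simplex (v # F) ys :: int"
  note V = admissible_finite_vertices[OF K] and F = admissible_facetD[OF K]
  have C: "?C \<in> chains (d + 1) ?V"
    using F v by (intro chains_sum oriented_simplex_chains) auto
  have cycle: "(\<Sum>w\<in>?V. \<Sum>F\<in>?\<Phi>. oriented_simplex F (w # zs) :: int) = 0" for zs
  proof -
    have "(\<Sum>w\<in>?V. \<Sum>F\<in>?\<Phi>. oriented_simplex F (w # zs) :: int) = (\<Sum>F\<in>?\<Phi>. simplex_boundary F zs)"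
      by (subst sum.swap, rule sum.cong[OF refl])
        (simp add: simplex_boundary_eq_sum_Cons[OF V F(2)])
    then show ?thesis using K by (simp add: admissible_def)
  qed
  \<comment> \<open>In the expansion along the column of \<open>v\<close>, the term of the entry \<open>w\<close> is split off.\<close>
  have Cons: "oriented_simplex (v # F) (w # ys) = (if w = v then oriented_simplex F ys else 0) -
      (\<Sum>i<length ys. if ys ! i = v then (-1) ^ i * oriented_simplex F (w # omit i ys) else 0 :: int)"
    for F w ys
    unfolding oriented_simplex_Cons_left[of v F "w # ys"]
    by (simp add: sum.lessThan_Suc_shift sum_negf[symmetric] del: sum.lessThan_Suc cong: if_cong)
      (auto intro!: sum.cong)
  have "boundary ?C ys = facet_chain K ys" for ys
  proof -
    have "boundary ?C ys = (\<Sum>w\<in>?V. \<Sum>F\<in>?\<Phi>. oriented_simplex (v # F) (w # ys))"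
      by (rule boundary_eq_sum_Cons[OF V C])
    also have "\<dots> = (\<Sum>w\<in>?V. \<Sum>F\<in>?\<Phi>. if w = v then oriented_simplex F ys else 0) -
       (\<Sum>w\<in>?V. \<Sum>F\<in>?\<Phi>. \<Sum>i<length ys.
          if ys ! i = v then (-1) ^ i * oriented_simplex F (w # omit i ys) else 0)"
      by (simp add: Cons sum_subtractf)
    also have "(\<Sum>w\<in>?V. \<Sum>F\<in>?\<Phi>. if w = v then oriented_simplex F ys else 0 :: int) = facet_chain K ys"
      unfolding facet_chain_def by (subst sum.swap) (use V v in simp)
    also have "(\<Sum>w\<in>?V. \<Sum>F\<in>?\<Phi>. \<Sum>i<length ys.
          if ys ! i = v then (-1) ^ i * oriented_simplex F (w # omit i ys) else 0 :: int) =
        (\<Sum>w\<in>?V. \<Sum>i<length ys. \<Sum>F\<in>?\<Phi>.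
          if ys ! i = v then (-1) ^ i * oriented_simplex F (w # omit i ys) else 0)"
      by (rule sum.cong[OF refl], rule sum.swap)
    also have "\<dots> = (\<Sum>i<length ys. \<Sum>w\<in>?V. \<Sum>F\<in>?\<Phi>.
          if ys ! i = v then (-1) ^ i * oriented_simplex F (w # omit i ys) else 0)"
      by (rule sum.swap)
    also have "\<dots> = (\<Sum>i<length ys. if ys ! i = v then
        (-1) ^ i * (\<Sum>w\<in>?V. \<Sum>F\<in>?\<Phi>. oriented_simplex F (w # omit i ys)) else 0)"
      by (rule sum.cong) (auto simp: sum_distrib_left)
    also have "\<dots> = 0" unfolding cycle by (auto intro!: sum.neutral)
    finally show ?thesis by simp
  qed
  with C show ?thesis unfolding filling_def by blast
qed

lemma filling_empty:
  assumes K: "admissible d K" and "vertices K = {}"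
  shows "filling d K (\<lambda>_. 0)"
proof -
  have "oriented_facets K = {}" using admissible_facetD[OF K] assms(2) by fastforce
  moreover have "(\<lambda>_. 0) \<in> chains (d + 1) (vertices K)" by (rule chainsI) auto
  moreover have "boundary (\<lambda>_. 0) ys = 0" for ys :: "'a list"
    by (simp add: boundary_def)
  ultimately show ?thesis by (auto simp: filling_def facet_chain_def fun_eq_iff)
qed

text \<open>
  Over the integers the minimum is attained. If \<open>K\<close> has no vertices there is no apex for a cone, and
  the zero chain is a filling.
\<close>

lemma filling_volume_attained:
  assumes K: "admissible d K"
  obtains \<alpha> where "filling d K \<alpha>" "chain_norm \<alpha> = (filling_volume d K :: int)"
    and "\<And>\<beta>. filling d K \<beta> \<Longrightarrow> (filling_volume d K :: int) \<le> chain_norm \<beta>"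
proof -
  have "\<exists>\<alpha> :: ('a, int) chain. filling d K \<alpha>"
    using cone_filling[OF K] filling_empty[OF K] by blast
  then obtain \<alpha> :: "('a, int) chain" where \<alpha>: "filling d K \<alpha>"
    and le: "\<And>\<beta>. filling d K \<beta> \<Longrightarrow> nat (chain_norm \<alpha>) \<le> nat (chain_norm \<beta>)"
    using ex_has_least_nat[of "filling d K" _ "\<lambda>\<alpha> :: ('a, int) chain. nat (chain_norm \<alpha>)"] by blast
  have le: "chain_norm \<alpha> \<le> chain_norm \<beta>" if "filling d K \<beta>" for \<beta>
    using le[OF that] chain_norm_nonneg[of \<alpha>] chain_norm_nonneg[of \<beta>] by linarith
  have "filling_volume d K = chain_norm \<alpha>"
    unfolding filling_volume_def
    by (rule Least_equality) (use \<alpha> le in \<open>auto simp: filling_def\<close>)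
  then show ?thesis using that[of \<alpha>] \<alpha> le by simp
qed


section \<open>Disjoint unions\<close>

lemma vertices_disjoint_union: "vertices (K \<squnion>\<^sub>c K') = Inl ` vertices K \<union> Inr ` vertices K'"
  by (auto simp: vertices_def disjoint_union_def)

lemma facet_chain_disjoint_union:
  assumes K: "admissible d K" and K': "admissible d K'"
  shows "facet_chain (K \<squnion>\<^sub>c K') = (\<lambda>ys. (\<Sum>F\<in>oriented_facets K. oriented_simplex (map Inl F) ys) +
    (\<Sum>F\<in>oriented_facets K'. oriented_simplex (map Inr F) ys))"
proof
  fix ys
  let ?\<Phi> = "oriented_facets K" and ?\<Phi>' = "oriented_facets K'"
  \<comment> \<open>Facets are nonempty lists; the empty list would have the same image under both inclusions.\<close>
  have disj: "map Inl ` ?\<Phi> \<inter> map Inr ` ?\<Phi>' = {}"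
  proof -
    have "map Inl F \<noteq> map Inr F'" if "F \<in> ?\<Phi>" for F F'
      using admissible_facetD(1)[OF K that] by (cases F; cases F') auto
    then show ?thesis by blast
  qed
  have inj: "inj_on (map Inl) ?\<Phi>" "inj_on (map Inr) ?\<Phi>'" by (auto simp: inj_on_def inj_map_eq_map)
  show "facet_chain (K \<squnion>\<^sub>c K') ys = (\<Sum>F\<in>?\<Phi>. oriented_simplex (map Inl F) ys) +
      (\<Sum>F\<in>?\<Phi>'. oriented_simplex (map Inr F) ys)"
    using admissible_finite_facets[OF K] admissible_finite_facets[OF K']
    by (simp add: facet_chain_def disjoint_union_def sum.union_disjoint[OF _ _ disj]
      sum.reindex[OF inj(1)] sum.reindex[OF inj(2)])
qed

text \<open>
  Let \<open>\<alpha>\<close> fill the copy of \<open>K\<close> embedded in \<open>W\<close> by \<open>e\<close> together with further simplices \<open>h G\<close> that have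
  at least two vertices, none of them in the copy. Collapsing the complement of the copy to one vertex
  of \<open>K\<close> yields a filling of \<open>K\<close>, and only simplices of \<open>\<alpha>\<close> with at most one vertex outside the
  copy contribute to its norm.
\<close>

lemma collapse_filling:
  fixes \<alpha> :: "('c, int) chain" and e :: "'a \<Rightarrow> 'c" and h :: "'b \<Rightarrow> 'c list"
  assumes K: "admissible d K" and W: "finite W" and \<alpha>: "\<alpha> \<in> chains (d + 1) W"
    and e: "inj_on e (vertices K)" "e ` vertices K \<subseteq> W"
    and bd: "boundary \<alpha> = (\<lambda>ys. (\<Sum>F\<in>oriented_facets K. oriented_simplex (map e F) ys) +
      (\<Sum>G\<in>J. oriented_simplex (h G) ys))"
    and h: "\<And>G. G \<in> J \<Longrightarrow> set (h G) \<subseteq> W - e ` vertices K" "\<And>G. G \<in> J \<Longrightarrow> length (h G) \<ge> 2"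
  obtains \<beta> :: "('a, int) chain" where "filling d K \<beta>"
    and "fact (d + 2) * chain_norm \<beta> \<le>
      (\<Sum>xs\<in>{xs \<in> vertex_lists (d + 2) W. length (filter (\<lambda>x. x \<notin> e ` vertices K) xs) \<le> 1}. \<bar>\<alpha> xs\<bar>)"
proof (cases "vertices K = {}")
  case True
  \<comment> \<open>There is no vertex to collapse to.\<close>
  let ?\<beta> = "(\<lambda>_. 0) :: ('a, int) chain"
  have "chain_norm ?\<beta> = 0" by (simp add: chain_norm_def chain_support_def)
  then show ?thesis using that[of ?\<beta>] filling_empty[OF K True] by (simp add: sum_nonneg)
next
  case False
  then obtain v where v: "v \<in> vertices K" by blast
  let ?V = "vertices K"
  define f where "f x = (if x \<in> e ` ?V then inv_into ?V e x else v)" for x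
  let ?\<beta> = "pushforward f W \<alpha>"
  note V = admissible_finite_vertices[OF K]
  have fW: "f ` W \<subseteq> ?V" using v by (auto simp: f_def inv_into_into)
  have at_most_one: "length (filter (\<lambda>x. x \<notin> e ` ?V) xs) \<le> 1" if "distinct (map f xs)" for xs
  proof -
    let ?xs = "filter (\<lambda>x. x \<notin> e ` ?V) xs"
    have "map f ?xs = replicate (length ?xs) v"
      by (rule nth_equalityI) (use nth_mem in \<open>fastforce simp: f_def\<close>)+
    then have "distinct (replicate (length ?xs) v)"
      using distinct_map_filter[OF that] by metis
    from distinct_card[OF this] show ?thesis by (simp add: set_replicate_conv_if split: if_splits)
  qed
  have \<beta>: "?\<beta> \<in> chains (d + 1) ?V" by (rule pushforward_chains[OF \<alpha> fW])
  moreover have "boundary ?\<beta> ys = facet_chain K ys" for ys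
  proof -
    have 1: "pushforward f W (oriented_simplex (map e F)) ys = (oriented_simplex F ys :: int)"
      if "F \<in> oriented_facets K" for F
    proof -
      have "set F \<subseteq> ?V" by (rule admissible_facetD[OF K that])
      moreover from this have "map f (map e F) = F"
        using e(1) by (auto simp: f_def intro!: map_idI)
      ultimately show ?thesis using e(2) by (subst pushforward_oriented_simplex[OF W]) auto
    qed
    have 2: "pushforward f W (oriented_simplex (h G)) ys = (0 :: int)" if "G \<in> J" for G
    proof -
      have "filter (\<lambda>x. x \<notin> e ` ?V) (h G) = h G" using h(1)[OF that] by (auto simp: filter_id_conv)
      then have "\<not> distinct (map f (h G))" using at_most_one[of "h G"] h(2)[OF that] by auto
      then show ?thesis
        using h(1)[OF that] by (subst pushforward_oriented_simplex[OF W])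
          (auto simp: oriented_simplex_not_distinct)
    qed
    show ?thesis
      unfolding boundary_pushforward[OF W V \<alpha> fW] bd pushforward_add pushforward_sum
      by (simp add: 1 2 facet_chain_def)
  qed
  ultimately have "filling d K ?\<beta>" unfolding filling_def by blast
  moreover have "fact (d + 2) * chain_norm ?\<beta> \<le>
      (\<Sum>xs\<in>{xs \<in> vertex_lists (d + 2) W. length (filter (\<lambda>x. x \<notin> e ` ?V) xs) \<le> 1}. \<bar>\<alpha> xs\<bar>)"
  proof -
    have "fact (d + 2) * chain_norm ?\<beta> = (\<Sum>ys\<in>vertex_lists (d + 2) ?V. \<bar>?\<beta> ys\<bar>)"
      using fact_mult_chain_norm[OF V \<beta>] by (simp add: add.commute)
    also have "\<dots> \<le> (\<Sum>xs\<in>{xs \<in> vertex_lists (d + 2) W. distinct (map f xs)}. \<bar>\<alpha> xs\<bar>)"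
      by (rule sum_abs_pushforward_le[OF W V \<alpha> fW])
    also have "\<dots> \<le> (\<Sum>xs\<in>{xs \<in> vertex_lists (d + 2) W. length (filter (\<lambda>x. x \<notin> e ` ?V) xs) \<le> 1}. \<bar>\<alpha> xs\<bar>)"
      by (rule sum_mono2) (use at_most_one in \<open>auto
        intro: finite_subset[OF _ finite_lists_length_eq[OF W, of "d + 2"]]\<close>)
    finally show ?thesis .
  qed
  ultimately show ?thesis by (rule that)
qed

lemma filling_volume_superadditive:
  fixes K :: "'a oriented_complex" and K' :: "'b oriented_complex" and \<alpha> :: "('a + 'b, int) chain"
  assumes d: "d \<ge> 1" and K: "admissible d K" and K': "admissible d K'"
    and \<alpha>: "filling d (K \<squnion>\<^sub>c K') \<alpha>"
  shows "filling_volume d K + filling_volume d K' \<le> chain_norm \<alpha>"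
proof -
  let ?W = "Inl ` vertices K \<union> Inr ` vertices K' :: ('a + 'b) set"
  let ?L = "vertex_lists (d + 2) ?W"
  let ?A = "{xs \<in> ?L. length (filter (\<lambda>x. x \<notin> Inl ` vertices K) xs) \<le> 1}"
  let ?B = "{xs \<in> ?L. length (filter (\<lambda>x. x \<notin> Inr ` vertices K') xs) \<le> 1}"
  have W: "finite ?W" using admissible_finite_vertices[OF K] admissible_finite_vertices[OF K'] by simp
  have ch: "\<alpha> \<in> chains (d + 1) ?W"
    and bd: "boundary \<alpha> = (\<lambda>ys. (\<Sum>F\<in>oriented_facets K. oriented_simplex (map Inl F) ys) +
      (\<Sum>F\<in>oriented_facets K'. oriented_simplex (map Inr F) ys))"
    using \<alpha> by (simp_all add: filling_def vertices_disjoint_union facet_chain_disjoint_union[OF K K'])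
  have bd': "boundary \<alpha> = (\<lambda>ys. (\<Sum>F\<in>oriented_facets K'. oriented_simplex (map Inr F) ys) +
      (\<Sum>F\<in>oriented_facets K. oriented_simplex (map Inl F) ys))"
    using bd by (simp add: add.commute)
  obtain \<beta> where \<beta>: "filling d K \<beta>" "fact (d + 2) * chain_norm \<beta> \<le> (\<Sum>xs\<in>?A. \<bar>\<alpha> xs\<bar>)"
    by (rule collapse_filling[OF K W ch _ _ bd])
      (use admissible_facetD[OF K'] d in \<open>fastforce+\<close>)
  obtain \<beta>' where \<beta>': "filling d K' \<beta>'" "fact (d + 2) * chain_norm \<beta>' \<le> (\<Sum>xs\<in>?B. \<bar>\<alpha> xs\<bar>)"
    by (rule collapse_filling[OF K' W ch _ _ bd'])
      (use admissible_facetD[OF K] d in \<open>fastforce+\<close>)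
  have L: "finite ?L" by (rule finite_lists_length_eq[OF W])
  \<comment> \<open>A list in both sets has at most one entry on each side, but it has \<open>d + 2 \<ge> 3\<close> entries.\<close>
  have "?A \<inter> ?B = {}"
  proof -
    have False if xs: "xs \<in> ?A" "xs \<in> ?B" for xs
    proof -
      have "filter (\<lambda>x. x \<in> Inl ` vertices K) xs = filter (\<lambda>x. x \<notin> Inr ` vertices K') xs"
        using xs by (intro filter_cong) auto
      then have "length xs \<le> 2"
        using xs sum_length_filter_compl[of "\<lambda>x. x \<in> Inl ` vertices K" xs] by simp
      then show False using xs d by simp
    qed
    then show ?thesis by blast
  qed
  then have "(\<Sum>xs\<in>?A. \<bar>\<alpha> xs\<bar>) + (\<Sum>xs\<in>?B. \<bar>\<alpha> xs\<bar>) = (\<Sum>xs\<in>?A \<union> ?B. \<bar>\<alpha> xs\<bar>)"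
    by (intro sum.union_disjoint[symmetric]) (auto intro: finite_subset[OF _ L])
  also have "\<dots> \<le> (\<Sum>xs\<in>?L. \<bar>\<alpha> xs\<bar>)"
    by (rule sum_mono2[OF L]) auto
  also have "\<dots> = fact (d + 2) * chain_norm \<alpha>"
    using fact_mult_chain_norm[OF W ch] by (simp add: add.commute)
  finally have "fact (d + 2) * (chain_norm \<beta> + chain_norm \<beta>') \<le> fact (d + 2) * chain_norm \<alpha>"
    using \<beta>(2) \<beta>'(2) by (simp add: distrib_left del: fact_Suc)
  then have "chain_norm \<beta> + chain_norm \<beta>' \<le> chain_norm \<alpha>"
    by (simp add: mult_le_cancel_left_pos del: fact_Suc)
  moreover have "filling_volume d K \<le> chain_norm \<beta>" "filling_volume d K' \<le> chain_norm \<beta>'"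
    using filling_volume_attained[OF K] filling_volume_attained[OF K'] \<beta>(1) \<beta>'(1) by metis+
  ultimately show ?thesis by linarith
qed

lemma filling_disjoint_union:
  fixes K :: "'a oriented_complex" and K' :: "'b oriented_complex"
    and \<beta> :: "('a, int) chain" and \<beta>' :: "('b, int) chain"
  assumes K: "admissible d K" and K': "admissible d K'"
    and \<beta>: "filling d K \<beta>" and \<beta>': "filling d K' \<beta>'"
  obtains \<alpha> where "filling d (K \<squnion>\<^sub>c K') \<alpha>" "chain_norm \<alpha> \<le> chain_norm \<beta> + chain_norm \<beta>'"
proof -
  let ?V = "vertices K" and ?V' = "vertices K'"
  let ?W = "Inl ` ?V \<union> Inr ` ?V' :: ('a + 'b) set"
  let ?\<gamma> = "pushforward Inl ?V \<beta> :: ('a + 'b, int) chain"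
  let ?\<gamma>' = "pushforward Inr ?V' \<beta>' :: ('a + 'b, int) chain"
  let ?\<alpha> = "\<lambda>ys. ?\<gamma> ys + ?\<gamma>' ys"
  note V = admissible_finite_vertices[OF K] and V' = admissible_finite_vertices[OF K']
  have W: "finite ?W" using V V' by simp
  have sub: "Inl ` ?V \<subseteq> ?W" "Inr ` ?V' \<subseteq> ?W" by auto
  have b: "\<beta> \<in> chains (d + 1) ?V" "boundary \<beta> = facet_chain K"
    and b': "\<beta>' \<in> chains (d + 1) ?V'" "boundary \<beta>' = facet_chain K'"
    using \<beta> \<beta>' by (auto simp: filling_def)
  have g: "?\<gamma> \<in> chains (d + 1) ?W" "?\<gamma>' \<in> chains (d + 1) ?W"
    using pushforward_chains[OF b(1) sub(1)] pushforward_chains[OF b'(1) sub(2)] by auto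
  have \<alpha>: "?\<alpha> \<in> chains (d + 1) ?W" by (rule chains_add[OF g])
  have "boundary ?\<alpha> ys = facet_chain (K \<squnion>\<^sub>c K') ys" for ys
  proof -
    have "boundary ?\<alpha> ys = boundary ?\<gamma> ys + boundary ?\<gamma>' ys"
      unfolding boundary_eq_sum_Cons[OF W \<alpha>] boundary_eq_sum_Cons[OF W g(1)]
        boundary_eq_sum_Cons[OF W g(2)] by (rule sum.distrib)
    also have "\<dots> = pushforward Inl ?V (facet_chain K) ys + pushforward Inr ?V' (facet_chain K') ys"
      by (simp only: boundary_pushforward[OF V W b(1) sub(1)]
          boundary_pushforward[OF V' W b'(1) sub(2)] b(2) b'(2))
    also have "\<dots> = facet_chain (K \<squnion>\<^sub>c K') ys"
      unfolding facet_chain_disjoint_union[OF K K']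
      by (simp add: facet_chain_def pushforward_sum pushforward_oriented_simplex[OF V]
        pushforward_oriented_simplex[OF V'] admissible_facetD(2)[OF K] admissible_facetD(2)[OF K'])
    finally show ?thesis .
  qed
  with \<alpha> have fill: "filling d (K \<squnion>\<^sub>c K') ?\<alpha>"
    unfolding filling_def vertices_disjoint_union by blast
  let ?n = "d + 1 + 1"
  have le: "(\<Sum>xs\<in>{xs \<in> vertex_lists ?n A. P xs}. \<bar>\<delta> xs\<bar>) \<le> (\<Sum>xs\<in>vertex_lists ?n A. \<bar>\<delta> xs\<bar>)"
    if "finite A" for A :: "'x set" and P and \<delta> :: "('x, int) chain"
    by (rule sum_mono2) (use finite_lists_length_eq[OF that] in auto)
  have "fact ?n * chain_norm ?\<alpha> = (\<Sum>ys\<in>vertex_lists ?n ?W. \<bar>?\<gamma> ys + ?\<gamma>' ys\<bar>)"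
    by (rule fact_mult_chain_norm[OF W \<alpha>])
  also have "\<dots> \<le> (\<Sum>ys\<in>vertex_lists ?n ?W. \<bar>?\<gamma> ys\<bar>) + (\<Sum>ys\<in>vertex_lists ?n ?W. \<bar>?\<gamma>' ys\<bar>)"
    unfolding sum.distrib[symmetric] by (rule sum_mono) (rule abs_triangle_ineq)
  also have "\<dots> \<le> (\<Sum>xs\<in>vertex_lists ?n ?V. \<bar>\<beta> xs\<bar>) + (\<Sum>xs\<in>vertex_lists ?n ?V'. \<bar>\<beta>' xs\<bar>)"
    using sum_abs_pushforward_le[OF V W b(1) sub(1), of ?n] le[OF V]
      sum_abs_pushforward_le[OF V' W b'(1) sub(2), of ?n] le[OF V']
    by (meson add_mono order_trans)
  also have "\<dots> = fact ?n * (chain_norm \<beta> + chain_norm \<beta>')"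
    by (simp only: fact_mult_chain_norm[OF V b(1)] fact_mult_chain_norm[OF V' b'(1)] distrib_left)
  finally have "chain_norm ?\<alpha> \<le> chain_norm \<beta> + chain_norm \<beta>'"
    by (simp add: mult_le_cancel_left_pos del: fact_Suc)
  with fill show ?thesis by (rule that)
qed

theorem theorem3:
  fixes d :: nat and K :: "'a oriented_complex" and K' :: "'b oriented_complex"
  assumes "d \<ge> 1"
    and "admissible d K"
    and "admissible d K'"
  shows "(filling_volume d (K \<squnion>\<^sub>c K') :: int) = filling_volume d K + filling_volume d K'"
proof -
  obtain \<beta> where \<beta>: "filling d K \<beta>" "chain_norm \<beta> = (filling_volume d K :: int)"
    using filling_volume_attained[OF assms(2)] by blast
  obtain \<beta>' where \<beta>': "filling d K' \<beta>'" "chain_norm \<beta>' = (filling_volume d K' :: int)"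
    using filling_volume_attained[OF assms(3)] by blast
  obtain \<alpha> where \<alpha>: "filling d (K \<squnion>\<^sub>c K') \<alpha>" "chain_norm \<alpha> \<le> chain_norm \<beta> + chain_norm \<beta>'"
    by (rule filling_disjoint_union[OF assms(2,3) \<beta>(1) \<beta>'(1)])
  have le: "filling_volume d K + filling_volume d K' \<le> chain_norm \<delta>" if "filling d (K \<squnion>\<^sub>c K') \<delta>"
    for \<delta> :: "('a + 'b, int) chain"
    by (rule filling_volume_superadditive[OF assms that])
  have "chain_norm \<alpha> = filling_volume d K + filling_volume d K'"
    using \<alpha>(2) \<beta>(2) \<beta>'(2) le[OF \<alpha>(1)] by simp
  then show ?thesis
    unfolding filling_volume_def[of d "K \<squnion>\<^sub>c K'"] using \<alpha>(1) le
    by (intro Least_equality) (auto simp: filling_def)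
qed

end
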